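(* For every positive integer $m$, $R_{2m,2m}=2R_{m,m}$. In particular $R_{m,m}$ and $R_{2m,2m}$ are similar figures.
   Context: For a positive integer $m$, the chocolate game $C_{m,m}$ is a two-player impartial game on an $m\times m$ chocolate bar of unit cells, exactly one of which is poisoned (known to both players); cells are $(i,j)\in\mathbb{Z}^2$ with $1\le i,j\le m$. Players alternately break the current bar along a grid line into two rectangular pieces, eat one and pass the other (always keeping the poisoned cell); a player who receives the $1\times1$ bar loses. A cell $(i,j)$ is a P-position if with poison at $(i,j)$ the second player has a winning strategy; $P_{m,m}$ denotes the set of P-positions. It is known that $(i,j)\in P_{m,m}$ iff $(i-1)\oplus(j-1)\oplus(m-i)\oplus(m-j)=0$ ($\oplus$ = bitwise XOR). The pattern is $R_{m,m}=\{(i-x,j-y)\in\mathbb{R}^2: 0\le x,y\le1,\ (i,j)\in P_{m,m}\}$, and for $A\subset\mathbb{R}^2$, $r\in\mathbb{R}$, $rA=\{(rx,ry):(x,y)\in A\}$. *)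

theory Defs
  imports "HOL-Analysis.Product_Vector"
begin

type_synonym cell = "int \<times> int"

definition full_bar :: "nat \<Rightarrow> cell set"
  where "full_bar m = {1..int m} \<times> {1..int m}"

definition break_along :: "cell set \<Rightarrow> cell set \<Rightarrow> cell set \<Rightarrow> bool"
  where "break_along B B1 B2 \<longleftrightarrow> B1 \<noteq> {} \<and> B2 \<noteq> {} \<and>
    ((\<exists>k. B1 = {(i, j) \<in> B. i \<le> k} \<and> B2 = {(i, j) \<in> B. i > k}) \<or>
     (\<exists>k. B1 = {(i, j) \<in> B. j \<le> k} \<and> B2 = {(i, j) \<in> B. j > k}))"

text \<open>In a legal move from \<open>B\<close> to \<open>B'\<close> the piece \<open>E\<close> is eaten; the poisoned cell \<open>p\<close>
  stays in the bar that is passed on.\<close>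

definition legal_move :: "cell \<Rightarrow> cell set \<Rightarrow> cell set \<Rightarrow> bool"
  where "legal_move p B B' \<longleftrightarrow>
    p \<in> B' \<and> (\<exists>E. break_along B B' E \<or> break_along B E B')"

text \<open>A (possibly unfinished) play is recorded as the list of bars received so far, beginning
  with the full bar received by the first player. Hence the last bar of a play \<open>Bs\<close> has been
  received by the first player iff \<open>length Bs\<close> is odd. A play is finished when the last bar
  is the single cell \<open>{p}\<close>.\<close>

definition is_play :: "nat \<Rightarrow> cell \<Rightarrow> cell set list \<Rightarrow> bool"
  where "is_play m p Bs \<longleftrightarrow>
    Bs \<noteq> [] \<and> hd Bs = full_bar m \<and> successively (legal_move p) Bs"

text \<open>A strategy may depend on the whole history of the play.\<close>

definition second_player_strategy :: "nat \<Rightarrow> cell \<Rightarrow> (cell set list \<Rightarrow> cell set) \<Rightarrow> bool"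
  where "second_player_strategy m p \<sigma> \<longleftrightarrow>
    (\<forall>Bs. is_play m p Bs \<and> even (length Bs) \<and> last Bs \<noteq> {p}
      \<longrightarrow> legal_move p (last Bs) (\<sigma> Bs))"

definition second_player_follows :: "(cell set list \<Rightarrow> cell set) \<Rightarrow> cell set list \<Rightarrow> bool"
  where "second_player_follows \<sigma> Bs \<longleftrightarrow>
    (\<forall>n. 0 < n \<and> n < length Bs \<and> even n \<longrightarrow> Bs ! n = \<sigma> (take n Bs))"

text \<open>Every play is finite because bars shrink strictly, so it suffices to look at finished plays.\<close>

definition second_player_wins :: "nat \<Rightarrow> cell \<Rightarrow> bool"
  where "second_player_wins m p \<longleftrightarrow>
    (\<exists>\<sigma>. second_player_strategy m p \<sigma> \<and>
      (\<forall>Bs. is_play m p Bs \<and> second_player_follows \<sigma> Bs \<and> last Bs = {p}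
        \<longrightarrow> odd (length Bs)))"

definition P_positions :: "nat \<Rightarrow> cell set"
  where "P_positions m = {p \<in> full_bar m. second_player_wins m p}"

definition pattern :: "nat \<Rightarrow> (real \<times> real) set"
  where "pattern m =
    {(real_of_int i - x, real_of_int j - y) | i j x y.
      0 \<le> x \<and> x \<le> 1 \<and> 0 \<le> y \<and> y \<le> 1 \<and> (i, j) \<in> P_positions m}"

text \<open>\<open>dist\<close> on \<open>real \<times> real\<close> is the Euclidean distance.\<close>

definition similar_figures :: "(real \<times> real) set \<Rightarrow> (real \<times> real) set \<Rightarrow> bool"
  where "similar_figures A B \<longleftrightarrow>
    (\<exists>f r. 0 < r \<and> bij f \<and> (\<forall>u v. dist (f u) (f v) = r * dist u v) \<and> f ` A = B)"

end

theory Submission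
  imports Defs
begin

text \<open>A bar in which the poisoned cell has \<open>l\<close>, \<open>r\<close>, \<open>d\<close>, \<open>u\<close> lines of cells on its four sides
  is the Nim position with heaps \<open>l\<close>, \<open>r\<close>, \<open>d\<close>, \<open>u\<close>: a break strictly decreases exactly one of
  them. Bouton's theorem therefore describes the P-positions by an exclusive or. Doubling the bar
  splits every cell into four; for either half of a split column exactly one of the two horizontal
  heaps \<open>2l\<close>, \<open>2r\<close> is increased by one, and likewise vertically. Hence the two additional
  lowest bits cancel and the exclusive or vanishes for the four small cells iff it vanishes for the
  original one.\<close>

unbundle bit_operations_syntax

section \<open>Four-heap Nim\<close>

lemma xor_div_2: "(a XOR b) div 2 = (a div 2) XOR (b div 2)" for a b :: nat
  by (simp add: xor_rec [of a b])

lemma xor_eq_0_iff: "a XOR b = 0 \<longleftrightarrow> a = b" for a b :: nat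
  by (metis xor.assoc xor.left_neutral xor.right_neutral xor_self_eq)

lemma xor_left_self: "a XOR (a XOR b) = b" for a b :: nat
  by (simp flip: xor.assoc)

text \<open>Each heap of a balanced position is determined by the other three. This is used both to
  exclude moves between balanced positions and to compare halves of heaps below.\<close>

lemma nim4_eq_0D:
  fixes a b c d :: nat
  assumes "a XOR b XOR c XOR d = 0"
  shows "b XOR c XOR d = a" "a XOR c XOR d = b" "a XOR b XOR d = c" "a XOR b XOR c = d"
proof -
  have a: "a = b XOR c XOR d"
    using assms by (simp add: xor_eq_0_iff)
  show "b XOR c XOR d = a" "a XOR c XOR d = b" "a XOR b XOR d = c" "a XOR b XOR c = d"
    by (simp_all add: a ac_simps xor_left_self)
qed

lemma nat_less_if_div_2_less: "a < b" if "a div 2 < b div 2" for a b :: nat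
  using that by linarith

lemma even_less_odd_same_half: "a < b" if "a div 2 = b div 2" "even a" "odd b" for a b :: nat
  using that by presburger

text \<open>Induction on the total size, stripping the lowest binary digit. If the halves are
  already out of balance, their winning reduction lifts, since a strict inequality of halves forces
  one of the numbers. Otherwise only the lowest digits are out of balance; some heap is then odd,
  and replacing it by the XOR of the other three just clears its lowest digit.\<close>

lemma nim4_winning_move:
  fixes a b c d :: nat
  assumes "a XOR b XOR c XOR d \<noteq> 0"
  shows "(b XOR c XOR d < a) \<or> (a XOR c XOR d < b) \<or> (a XOR b XOR d < c) \<or> (a XOR b XOR c < d)"
  using assms
proof (induction "a + b + c + d" arbitrary: a b c d rule: less_induct)
  case less
  let ?a = "a div 2" and ?b = "b div 2" and ?c = "c div 2" and ?d = "d div 2"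
  show ?case
  proof (cases "?a XOR ?b XOR ?c XOR ?d = 0")
    case False
    have "a + b + c + d \<noteq> 0"
      using less.prems by auto
    then have "?a + ?b + ?c + ?d < a + b + c + d"
      by linarith
    from less.hyps [OF this False]
    show ?thesis
      by (auto simp flip: xor_div_2 dest: nat_less_if_div_2_less)
  next
    case True
    note eqs = nim4_eq_0D [OF True]
    have "(a XOR b XOR c XOR d) div 2 = 0"
      using True by (simp add: xor_div_2)
    with less.prems have "odd (a XOR b XOR c XOR d)"
      by presburger
    then have odd: "odd a \<noteq> (odd b \<noteq> (odd c \<noteq> odd d))"
      by (auto simp: even_xor_iff)
    then consider "odd a" | "odd b" | "odd c" | "odd d"
      by blast
    then show ?thesis
    proof cases
      case 1
      have "b XOR c XOR d < a"
        by (rule even_less_odd_same_half) (use 1 odd eqs in \<open>auto simp: xor_div_2 even_xor_iff\<close>)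
      then show ?thesis by blast
    next
      case 2
      have "a XOR c XOR d < b"
        by (rule even_less_odd_same_half) (use 2 odd eqs in \<open>auto simp: xor_div_2 even_xor_iff\<close>)
      then show ?thesis by blast
    next
      case 3
      have "a XOR b XOR d < c"
        by (rule even_less_odd_same_half) (use 3 odd eqs in \<open>auto simp: xor_div_2 even_xor_iff\<close>)
      then show ?thesis by blast
    next
      case 4
      have "a XOR b XOR c < d"
        by (rule even_less_odd_same_half) (use 4 odd eqs in \<open>auto simp: xor_div_2 even_xor_iff\<close>)
      then show ?thesis by blast
    qed
  qed
qed

section \<open>Bars as Nim positions\<close>

definition bar :: "cell \<Rightarrow> nat \<Rightarrow> nat \<Rightarrow> nat \<Rightarrow> nat \<Rightarrow> cell set"
  where "bar p l r d u =
    {fst p - int l..fst p + int r} \<times> {snd p - int d..snd p + int u}"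

definition balanced :: "cell \<Rightarrow> cell set \<Rightarrow> bool"
  where "balanced p B \<longleftrightarrow> (\<exists>l r d u. B = bar p l r d u \<and> l XOR r XOR d XOR u = 0)"

text \<open>Not the negation of \<open>balanced\<close>: a set that is not of the form
  \<open>bar p l r d u\<close> satisfies neither, so both predicates carry the shape of the bar
  through a play.\<close>

definition unbalanced :: "cell \<Rightarrow> cell set \<Rightarrow> bool"
  where "unbalanced p B \<longleftrightarrow> (\<exists>l r d u. B = bar p l r d u \<and> l XOR r XOR d XOR u \<noteq> 0)"

lemma finite_bar: "finite (bar p l r d u)"
  by (simp add: bar_def)

text \<open>Both intervals contain the corresponding coordinate of \<open>p\<close>, so they are
  nonempty and the product determines their endpoints.\<close>

lemma bar_eq_iff:
  "bar p l r d u = bar p l' r' d' u' \<longleftrightarrow> l = l' \<and> r = r' \<and> d = d' \<and> u = u'"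
  by (auto simp: bar_def times_eq_iff Icc_eq_Icc)

lemma bar_0: "bar p 0 0 0 0 = {p}"
  by (cases p) (simp add: bar_def)

lemma balanced_bar_iff: "balanced p (bar p l r d u) \<longleftrightarrow> l XOR r XOR d XOR u = 0"
  by (auto simp: balanced_def bar_eq_iff)

lemma unbalanced_bar_iff: "unbalanced p (bar p l r d u) \<longleftrightarrow> l XOR r XOR d XOR u \<noteq> 0"
  by (auto simp: unbalanced_def bar_eq_iff)

lemma balanced_singleton: "balanced p {p}"
  by (simp flip: bar_0 add: balanced_bar_iff)

lemma unbalanced_imp_not_balanced: "unbalanced p B \<Longrightarrow> \<not> balanced p B"
  by (auto simp: unbalanced_def balanced_bar_iff)

text \<open>The poisoned cell and the witness \<open>e\<close> make both pieces nonempty, so only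
  the shape of the cut remains to be checked.\<close>

lemma legal_moveI:
  assumes "p \<in> B'" "e \<in> E"
    "(\<exists>k. B' = {(i, j) \<in> B. i \<le> k} \<and> E = {(i, j) \<in> B. i > k}) \<or>
     (\<exists>k. B' = {(i, j) \<in> B. j \<le> k} \<and> E = {(i, j) \<in> B. j > k}) \<or>
     (\<exists>k. E = {(i, j) \<in> B. i \<le> k} \<and> B' = {(i, j) \<in> B. i > k}) \<or>
     (\<exists>k. E = {(i, j) \<in> B. j \<le> k} \<and> B' = {(i, j) \<in> B. j > k})"
  shows "legal_move p B B'"
proof -
  have "B' \<noteq> {}" "E \<noteq> {}"
    using assms(1,2) by auto
  with assms(3) have "break_along B B' E \<or> break_along B E B'"
    unfolding break_along_def by (elim disjE) simp_all
  with assms(1) show ?thesis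
    unfolding legal_move_def by blast
qed

text \<open>A cut that keeps \<open>p\<close> shortens the bar on one side only. The heap on that
  side decreases strictly because the eaten piece is nonempty, and every smaller value comes from a
  suitable cut.\<close>

lemma legal_move_bar_iff:
  "legal_move p (bar p l r d u) B' \<longleftrightarrow>
    (\<exists>x<l. B' = bar p x r d u) \<or> (\<exists>x<r. B' = bar p l x d u) \<or>
    (\<exists>x<d. B' = bar p l r x u) \<or> (\<exists>x<u. B' = bar p l r d x)"
    (is "?L \<longleftrightarrow> ?R")
proof
  obtain i j where p: "p = (i, j)" by fastforce
  let ?B = "bar p l r d u"
  have mem: "(i', j') \<in> bar p l' r' d' u' \<longleftrightarrow>
    i - int l' \<le> i' \<and> i' \<le> i + int r' \<and> j - int d' \<le> j' \<and> j' \<le> j + int u'" for i' j' l' r' d' u'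
    by (auto simp: bar_def p)
  {
    assume ?L
    then obtain E where pB: "(i, j) \<in> B'" and brk: "break_along ?B B' E \<or> break_along ?B E B'"
      by (auto simp: legal_move_def p)
    then obtain e where e: "e \<in> E"
      by (auto simp: break_along_def)
    \<comment> \<open>Two directions of the cut and two choices of the passed piece: one case per
      heap.\<close>
    have cases:
      "(\<exists>k. B' = {(i, j) \<in> ?B. i \<le> k} \<and> E = {(i, j) \<in> ?B. i > k}) \<or>
       (\<exists>k. B' = {(i, j) \<in> ?B. j \<le> k} \<and> E = {(i, j) \<in> ?B. j > k}) \<or>
       (\<exists>k. E = {(i, j) \<in> ?B. i \<le> k} \<and> B' = {(i, j) \<in> ?B. i > k}) \<or>
       (\<exists>k. E = {(i, j) \<in> ?B. j \<le> k} \<and> B' = {(i, j) \<in> ?B. j > k})"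
      using brk unfolding break_along_def by argo
    from cases show ?R
    proof (elim disjE exE conjE)
      fix k assume B: "B' = {(i, j) \<in> ?B. i \<le> k}" and E: "E = {(i, j) \<in> ?B. i > k}"
      \<comment> \<open>Since \<open>p\<close> lies in \<open>B'\<close>, \<open>k - i\<close> is
        nonnegative and \<open>nat\<close> does not truncate; the eaten cell \<open>e\<close> lies
        beyond \<open>k\<close>, hence the strict bound.\<close>
      have "nat (k - i) < r" using pB e unfolding B E by (auto simp: mem)
      moreover have "B' = bar p l (nat (k - i)) d u" using pB e unfolding B E by (auto simp: mem)
      ultimately show ?R by blast
    next
      fix k assume B: "B' = {(i, j) \<in> ?B. j \<le> k}" and E: "E = {(i, j) \<in> ?B. j > k}"
      have "nat (k - j) < u" using pB e unfolding B E by (auto simp: mem)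
      moreover have "B' = bar p l r d (nat (k - j))" using pB e unfolding B E by (auto simp: mem)
      ultimately show ?R by blast
    next
      fix k assume E: "E = {(i, j) \<in> ?B. i \<le> k}" and B: "B' = {(i, j) \<in> ?B. i > k}"
      \<comment> \<open>The first kept line of cells is \<open>k + 1\<close>, so the new heap is
        \<open>i - (k + 1)\<close>.\<close>
      have "nat (i - k - 1) < l" using pB e unfolding B E by (auto simp: mem)
      moreover have "B' = bar p (nat (i - k - 1)) r d u"
        using pB e unfolding B E by (auto simp: mem)
      ultimately show ?R by blast
    next
      fix k assume E: "E = {(i, j) \<in> ?B. j \<le> k}" and B: "B' = {(i, j) \<in> ?B. j > k}"
      have "nat (j - k - 1) < d" using pB e unfolding B E by (auto simp: mem)
      moreover have "B' = bar p l r (nat (j - k - 1)) u"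
        using pB e unfolding B E by (auto simp: mem)
      ultimately show ?R by blast
    qed
  }
  {
    assume ?R
    then show ?L
    proof (elim disjE exE conjE)
      fix x assume x: "x < l" and B': "B' = bar p x r d u"
      have B'_eq: "B' = {(i', j') \<in> ?B. i' > i - int x - 1}" using x by (auto simp: B' mem)
      have p_in: "p \<in> B'" by (simp add: B' bar_def mem_Times_iff)
      \<comment> \<open>The extreme cell of the old bar, in line with \<open>p\<close>, witnesses
        that something is eaten.\<close>
      have e: "(i - int l, j) \<in> {(i', j') \<in> ?B. i' \<le> i - int x - 1}"
        using x by (auto simp: mem)
      show ?L using B'_eq by (intro legal_moveI [OF p_in e]) blast
    next
      fix x assume x: "x < r" and B': "B' = bar p l x d u"
      have B'_eq: "B' = {(i', j') \<in> ?B. i' \<le> i + int x}" using x by (auto simp: B' mem)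
      have p_in: "p \<in> B'" by (simp add: B' bar_def mem_Times_iff)
      have e: "(i + int r, j) \<in> {(i', j') \<in> ?B. i' > i + int x}"
        using x by (auto simp: mem)
      show ?L using B'_eq by (intro legal_moveI [OF p_in e]) blast
    next
      fix x assume x: "x < d" and B': "B' = bar p l r x u"
      have B'_eq: "B' = {(i', j') \<in> ?B. j' > j - int x - 1}" using x by (auto simp: B' mem)
      have p_in: "p \<in> B'" by (simp add: B' bar_def mem_Times_iff)
      have e: "(i, j - int d) \<in> {(i', j') \<in> ?B. j' \<le> j - int x - 1}"
        using x by (auto simp: mem)
      show ?L using B'_eq by (intro legal_moveI [OF p_in e]) blast
    next
      fix x assume x: "x < u" and B': "B' = bar p l r d x"
      have B'_eq: "B' = {(i', j') \<in> ?B. j' \<le> j + int x}" using x by (auto simp: B' mem)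
      have p_in: "p \<in> B'" by (simp add: B' bar_def mem_Times_iff)
      have e: "(i, j + int u) \<in> {(i', j') \<in> ?B. j' > j + int x}"
        using x by (auto simp: mem)
      show ?L using B'_eq by (intro legal_moveI [OF p_in e]) blast
    qed
  }
qed

lemma break_along_partition:
  "break_along B B1 B2 \<Longrightarrow> B1 \<noteq> {} \<and> B2 \<noteq> {} \<and> B1 \<inter> B2 = {} \<and> B1 \<union> B2 = B"
  unfolding break_along_def by (elim conjE disjE exE) auto

text \<open>Supplies the decreasing measure for play against a given strategy.\<close>

lemma legal_move_psubset: "legal_move p B B' \<Longrightarrow> B' \<subset> B"
  unfolding legal_move_def by (fastforce dest: break_along_partition)

text \<open>A move keeps three heaps, and in a balanced bar these determine the fourth; a balanced
  result would therefore leave the altered heap unchanged.\<close>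

lemma legal_move_from_balanced:
  assumes "balanced p B" "legal_move p B B'"
  shows "unbalanced p B'"
proof -
  obtain l r d u where B: "B = bar p l r d u" and zero: "l XOR r XOR d XOR u = 0"
    using assms(1) by (auto simp: balanced_def)
  note eqs = nim4_eq_0D [OF zero]
  have "x = l" if "x XOR r XOR d XOR u = 0" for x
    using nim4_eq_0D(1) [OF that] eqs(1) by simp
  moreover have "x = r" if "l XOR x XOR d XOR u = 0" for x
    using nim4_eq_0D(2) [OF that] eqs(2) by simp
  moreover have "x = d" if "l XOR r XOR x XOR u = 0" for x
    using nim4_eq_0D(3) [OF that] eqs(3) by simp
  moreover have "x = u" if "l XOR r XOR d XOR x = 0" for x
    using nim4_eq_0D(4) [OF that] eqs(4) by simp
  ultimately show ?thesis
    using assms(2) unfolding B legal_move_bar_iff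
    by (elim disjE exE conjE) (metis unbalanced_bar_iff less_irrefl)+
qed

lemma unbalanced_winning_move:
  assumes "unbalanced p B"
  shows "\<exists>B'. legal_move p B B' \<and> balanced p B'"
proof -
  obtain l r d u where B: "B = bar p l r d u" and "l XOR r XOR d XOR u \<noteq> 0"
    using assms by (auto simp: unbalanced_def)
  from nim4_winning_move [OF this(2)]
  consider "r XOR d XOR u < l" | "l XOR d XOR u < r" | "l XOR r XOR u < d" | "l XOR r XOR d < u"
    by blast
  then show ?thesis
  proof cases
    case 1
    have "balanced p (bar p (r XOR d XOR u) r d u)" by (simp add: balanced_bar_iff)
    then show ?thesis using 1 unfolding B legal_move_bar_iff by blast
  next
    case 2
    have "balanced p (bar p l (l XOR d XOR u) d u)"
      by (simp add: balanced_bar_iff ac_simps xor_left_self)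
    then show ?thesis using 2 unfolding B legal_move_bar_iff by blast
  next
    case 3
    have "balanced p (bar p l r (l XOR r XOR u) u)"
      by (simp add: balanced_bar_iff ac_simps xor_left_self)
    then show ?thesis using 3 unfolding B legal_move_bar_iff by blast
  next
    case 4
    have "balanced p (bar p l r d (l XOR r XOR d))"
      by (simp add: balanced_bar_iff ac_simps xor_left_self)
    then show ?thesis using 4 unfolding B legal_move_bar_iff by blast
  qed
qed

lemma bar_move_exists:
  assumes "bar p l r d u \<noteq> {p}"
  shows "\<exists>B'. legal_move p (bar p l r d u) B'"
proof -
  have "0 < l \<or> 0 < r \<or> 0 < d \<or> 0 < u"
    using assms by (metis bar_0 gr0I)
  then show ?thesis
    unfolding legal_move_bar_iff by blast
qed

lemma full_bar_eq_bar:
  assumes "(i, j) \<in> full_bar m"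
  shows "full_bar m = bar (i, j) (nat (i - 1)) (nat (int m - i)) (nat (j - 1)) (nat (int m - j))"
  using assms by (simp add: full_bar_def bar_def)

section \<open>Strategies\<close>

lemma is_play_snoc:
  "Bs \<noteq> [] \<Longrightarrow> is_play m p (Bs @ [B]) \<longleftrightarrow> is_play m p Bs \<and> legal_move p (last Bs) B"
  by (auto simp: is_play_def successively_append_iff)

text \<open>A list of even length ends with a bar received by the second player, so exactly then
  \<open>\<sigma>\<close> prescribes the appended bar.\<close>

lemma second_player_follows_snoc:
  assumes "Bs \<noteq> []"
  shows "second_player_follows \<sigma> (Bs @ [B]) \<longleftrightarrow>
    second_player_follows \<sigma> Bs \<and> (even (length Bs) \<longrightarrow> B = \<sigma> Bs)"
  using assms by (auto simp: second_player_follows_def nth_append less_Suc_eq)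

text \<open>Needed for arbitrary plays, since \<open>second_player_strategy\<close> demands a legal
  reply even in plays that do not follow the strategy.\<close>

lemma play_last_bar:
  assumes "is_play m p Bs" "p \<in> full_bar m"
  shows "\<exists>l r d u. last Bs = bar p l r d u"
  using assms(1)
proof (induction Bs rule: rev_induct)
  case Nil
  then show ?case by (simp add: is_play_def)
next
  case (snoc B Bs)
  show ?case
  proof (cases "Bs = []")
    case True
    with snoc.prems assms(2) show ?thesis
      by (metis append_Nil full_bar_eq_bar is_play_def last.simps list.sel(1) surj_pair)
  next
    case False
    with snoc obtain l r d u where "last Bs = bar p l r d u" "legal_move p (last Bs) B"
      by (auto simp: is_play_snoc)
    then show ?thesis
      by (auto simp: legal_move_bar_iff)
  qed
qed

text \<open>In plays that follow \<open>\<sigma>\<close>, the first player always receives a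
  balanced bar and the second an unbalanced one. As \<open>{p}\<close> is balanced, it is the first
  player who receives it.\<close>

lemma second_player_wins_if_balanced:
  assumes bal: "balanced p (full_bar m)" and p: "p \<in> full_bar m"
  shows "second_player_wins m p"
proof -
  define \<sigma> where "\<sigma> Bs = (if unbalanced p (last Bs)
    then SOME B. legal_move p (last Bs) B \<and> balanced p B
    else SOME B. legal_move p (last Bs) B)" for Bs :: "cell set list"
  have \<sigma>_unbalanced: "legal_move p (last Bs) (\<sigma> Bs) \<and> balanced p (\<sigma> Bs)"
    if "unbalanced p (last Bs)" for Bs
    using someI_ex [OF unbalanced_winning_move [OF that]] that by (simp add: \<sigma>_def)
  have "second_player_strategy m p \<sigma>"
    unfolding second_player_strategy_def
  proof (intro allI impI, elim conjE)
    fix Bs assume "is_play m p Bs" "last Bs \<noteq> {p}"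
    then have "\<exists>B. legal_move p (last Bs) B"
      using play_last_bar [OF _ p] bar_move_exists by metis
    then have "legal_move p (last Bs) (SOME B. legal_move p (last Bs) B)"
      by (rule someI_ex)
    then show "legal_move p (last Bs) (\<sigma> Bs)"
      using \<sigma>_unbalanced by (cases "unbalanced p (last Bs)") (auto simp: \<sigma>_def)
  qed
  moreover have invariant: "if odd (length Bs) then balanced p (last Bs) else unbalanced p (last Bs)"
    if "is_play m p Bs" "second_player_follows \<sigma> Bs" for Bs
    using that
  proof (induction Bs rule: rev_induct)
    case Nil
    then show ?case by (simp add: is_play_def)
  next
    case (snoc B Bs)
    show ?case
    proof (cases "Bs = []")
      case True
      with snoc.prems bal show ?thesis by (simp add: is_play_def)
    next
      case False
      with snoc have IH: "if odd (length Bs) then balanced p (last Bs) else unbalanced p (last Bs)"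
        and move: "legal_move p (last Bs) B" and B: "even (length Bs) \<longrightarrow> B = \<sigma> Bs"
        by (auto simp: is_play_snoc second_player_follows_snoc)
      show ?thesis
        using IH move B \<sigma>_unbalanced legal_move_from_balanced by (auto split: if_splits)
    qed
  qed
  moreover have "odd (length Bs)"
    if "is_play m p Bs" "second_player_follows \<sigma> Bs" "last Bs = {p}" for Bs
    using invariant [OF that(1,2)] that(3) balanced_singleton unbalanced_imp_not_balanced
    by (metis (full_types))
  ultimately show ?thesis
    unfolding second_player_wins_def by blast
qed

text \<open>The first player restores balance at every turn. If this does not yet reach
  \<open>{p}\<close>, the reply of \<open>\<sigma>\<close> is again unbalanced, and the induction
  continues with a strictly smaller bar.\<close>

lemma first_player_beats_strategy:
  assumes \<sigma>: "second_player_strategy m p \<sigma>"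
    and "is_play m p Bs" "second_player_follows \<sigma> Bs" "odd (length Bs)" "unbalanced p (last Bs)"
  shows "\<exists>Cs. is_play m p Cs \<and> second_player_follows \<sigma> Cs \<and> last Cs = {p} \<and> even (length Cs)"
  using assms(2-)
proof (induction "card (last Bs)" arbitrary: Bs rule: less_induct)
  case less
  then have ne: "Bs \<noteq> []" by auto
  obtain B where B: "legal_move p (last Bs) B" "balanced p B"
    using unbalanced_winning_move less.prems(4) by blast
  let ?Cs = "Bs @ [B]"
  have Cs: "is_play m p ?Cs" "second_player_follows \<sigma> ?Cs" "even (length ?Cs)" "last ?Cs = B"
    using less.prems B ne by (auto simp: is_play_snoc second_player_follows_snoc)
  show ?case
  proof (cases "B = {p}")
    case True
    with Cs show ?thesis by blast
  next
    case False
    let ?D = "\<sigma> ?Cs"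
    have D: "legal_move p B ?D"
      using \<sigma> Cs False unfolding second_player_strategy_def by metis
    have "finite (last Bs)"
      using less.prems(4) by (auto simp: unbalanced_def finite_bar)
    moreover have "?D \<subset> last Bs"
      using legal_move_psubset [OF B(1)] legal_move_psubset [OF D] by blast
    ultimately have "card (last (?Cs @ [?D])) < card (last Bs)"
      by (simp add: psubset_card_mono)
    moreover have "is_play m p (?Cs @ [?D])"
      using Cs D by (subst is_play_snoc) auto
    moreover have "second_player_follows \<sigma> (?Cs @ [?D])"
      using Cs by (subst second_player_follows_snoc) auto
    moreover have "odd (length (?Cs @ [?D]))"
      using Cs by simp
    moreover have "unbalanced p (last (?Cs @ [?D]))"
      using legal_move_from_balanced [OF B(2) D] by simp
    ultimately show ?thesis
      by (rule less.hyps)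
  qed
qed

lemma not_second_player_wins_if_unbalanced:
  assumes "unbalanced p (full_bar m)"
  shows "\<not> second_player_wins m p"
proof
  assume "second_player_wins m p"
  then obtain \<sigma> where \<sigma>: "second_player_strategy m p \<sigma>"
    and win: "\<And>Bs. is_play m p Bs \<Longrightarrow> second_player_follows \<sigma> Bs \<Longrightarrow> last Bs = {p} \<Longrightarrow> odd (length Bs)"
    unfolding second_player_wins_def by blast
  have "is_play m p [full_bar m]" "second_player_follows \<sigma> [full_bar m]"
    by (auto simp: is_play_def second_player_follows_def)
  from first_player_beats_strategy [OF \<sigma> this] assms
  obtain Cs where "is_play m p Cs" "second_player_follows \<sigma> Cs" "last Cs = {p}" "even (length Cs)"
    by auto
  with win show False
    by blast
qed

section \<open>P-positions and doubling\<close>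

text \<open>Bouton's criterion for the game. The heaps are listed by axis, so that the XOR splits
  into a horizontal and a vertical pair.\<close>

theorem P_positions_iff:
  "(i, j) \<in> P_positions m \<longleftrightarrow> (i, j) \<in> full_bar m \<and>
    nat (i - 1) XOR nat (int m - i) XOR nat (j - 1) XOR nat (int m - j) = 0"
proof (cases "(i, j) \<in> full_bar m")
  case True
  let ?s = "nat (i - 1) XOR nat (int m - i) XOR nat (j - 1) XOR nat (int m - j)"
  have "balanced (i, j) (full_bar m) \<longleftrightarrow> ?s = 0" "unbalanced (i, j) (full_bar m) \<longleftrightarrow> ?s \<noteq> 0"
    by (simp_all only: full_bar_eq_bar [OF True] balanced_bar_iff unbalanced_bar_iff)
  then have "second_player_wins m (i, j) \<longleftrightarrow> ?s = 0"
    using second_player_wins_if_balanced [OF _ True] not_second_player_wins_if_unbalanced by blast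
  with True show ?thesis
    by (simp add: P_positions_def)
qed (simp add: P_positions_def)

text \<open>One of the two new heaps is even and the other odd, so the lowest bit of their XOR is 1
  for either half \<open>I\<close> of the line \<open>i\<close>.\<close>

lemma xor_doubled_heaps:
  assumes "i \<in> {1..int m}" "I = 2 * i \<or> I = 2 * i - 1"
  shows "nat (I - 1) XOR nat (int (2 * m) - I) = Suc (2 * (nat (i - 1) XOR nat (int m - i)))"
proof -
  define a b where "a = nat (i - 1)" and "b = nat (int m - i)"
  have "nat (I - 1) = Suc (2 * a) \<and> nat (int (2 * m) - I) = 2 * b \<or>
    nat (I - 1) = 2 * a \<and> nat (int (2 * m) - I) = Suc (2 * b)"
    using assms by (auto simp: a_def b_def)
  then show ?thesis
    unfolding a_def [symmetric] b_def [symmetric]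
    by (elim disjE conjE) (simp_all add: xor_rec [of "Suc (2 * a)"] xor_rec [of "2 * a"])
qed

lemma P_positions_double_iff:
  assumes "I = 2 * i \<or> I = 2 * i - 1" "J = 2 * j \<or> J = 2 * j - 1"
  shows "(I, J) \<in> P_positions (2 * m) \<longleftrightarrow> (i, j) \<in> P_positions m"
proof -
  have full: "(I, J) \<in> full_bar (2 * m) \<longleftrightarrow> (i, j) \<in> full_bar m"
    using assms by (auto simp: full_bar_def)
  show ?thesis
  proof (cases "(i, j) \<in> full_bar m")
    case True
    then have "i \<in> {1..int m}" "j \<in> {1..int m}"
      by (auto simp: full_bar_def)
    note eqs = xor_doubled_heaps [OF this(1) assms(1)] xor_doubled_heaps [OF this(2) assms(2)]
    have "nat (I - 1) XOR nat (int (2 * m) - I) XOR nat (J - 1) XOR nat (int (2 * m) - J) = 0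
      \<longleftrightarrow> nat (i - 1) XOR nat (int m - i) XOR nat (j - 1) XOR nat (int m - j) = 0"
      \<comment> \<open>Grouped by axis, the XOR vanishes iff the two pairs have equal XOR, and
        \<open>Suc (2 * _)\<close> is injective.\<close>
      unfolding xor.assoc [symmetric, of "nat (I - 1)"] xor.assoc [symmetric, of "nat (i - 1)"]
        xor_eq_0_iff eqs by simp
    then show ?thesis
      using full by (simp add: P_positions_iff)
  qed (use full in \<open>simp add: P_positions_iff\<close>)
qed

section \<open>Doubling the pattern, one coordinate at a time\<close>

lemma half_cell_cases:
  obtains i :: int where "I = 2 * i \<or> I = 2 * i - 1"
proof
  \<comment> \<open>Half of \<open>I\<close>, rounded up, because cell \<open>i\<close> extends from
    \<open>i - 1\<close> to \<open>i\<close>.\<close>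
  show "I = 2 * ((I + 1) div 2) \<or> I = 2 * ((I + 1) div 2) - 1"
    by presburger
qed

text \<open>The interval from \<open>i - 1\<close> to \<open>i\<close> doubles to the union of the
  cells \<open>2 * i - 1\<close> and \<open>2 * i\<close>; offsets are measured downwards from the
  upper end, so small \<open>x\<close> falls into cell \<open>2 * i\<close>.\<close>

lemma unit_interval_double:
  fixes x :: real
  assumes "0 \<le> x" "x \<le> 1"
  obtains I x' where "I = 2 * i \<or> I = 2 * i - 1" "0 \<le> x'" "x' \<le> 1"
    "2 * (real_of_int i - x) = real_of_int I - x'"
proof (cases "x \<le> 1 / 2")
  case True
  show ?thesis
    by (rule that [of "2 * i" "2 * x"]) (use True assms in auto)
next
  case False
  show ?thesis
    by (rule that [of "2 * i - 1" "2 * x - 1"]) (use False assms in auto)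
qed

lemma unit_interval_half:
  fixes x :: real
  assumes "0 \<le> x" "x \<le> 1"
  obtains i x' where "I = 2 * i \<or> I = 2 * i - 1" "0 \<le> x'" "x' \<le> 1"
    "2 * (real_of_int i - x') = real_of_int I - x"
proof -
  obtain i where i: "I = 2 * i \<or> I = 2 * i - 1"
    by (rule half_cell_cases)
  show ?thesis
    \<comment> \<open>The offset is the solution of the required equation; \<open>2 * i - I\<close>
      is 0 or 1, which keeps it in the unit interval.\<close>
    by (rule that [OF i, of "x / 2 + real_of_int (2 * i - I) / 2"]) (use i assms in auto)
qed

text \<open>Each coordinate is moved to a half cell or back independently, and
  \<open>P_positions_double_iff\<close> holds for whichever halves occur.\<close>

lemma pattern_double: "pattern (2 * m) = (\<lambda>z. (2::real) *\<^sub>R z) ` pattern m"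
proof (intro equalityI subsetI)
  fix z assume "z \<in> pattern (2 * m)"
  then obtain I J x y where z: "z = (real_of_int I - x, real_of_int J - y)"
    and x: "0 \<le> x" "x \<le> 1" and y: "0 \<le> y" "y \<le> 1" and P: "(I, J) \<in> P_positions (2 * m)"
    unfolding pattern_def by blast
  obtain i x' where i: "I = 2 * i \<or> I = 2 * i - 1" and x': "0 \<le> x'" "x' \<le> 1"
    "2 * (real_of_int i - x') = real_of_int I - x"
    by (rule unit_interval_half [OF x])
  obtain j y' where j: "J = 2 * j \<or> J = 2 * j - 1" and y': "0 \<le> y'" "y' \<le> 1"
    "2 * (real_of_int j - y') = real_of_int J - y"
    by (rule unit_interval_half [OF y])
  have "(real_of_int i - x', real_of_int j - y') \<in> pattern m"
    using P x' y' unfolding P_positions_double_iff [OF i j] pattern_def by blast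
  moreover have "z = 2 *\<^sub>R (real_of_int i - x', real_of_int j - y')"
    by (simp only: z scaleR_Pair real_scaleR_def x' y')
  ultimately show "z \<in> (\<lambda>z. 2 *\<^sub>R z) ` pattern m"
    by blast
next
  fix z assume "z \<in> (\<lambda>z. (2::real) *\<^sub>R z) ` pattern m"
  then obtain i j x y where z: "z = 2 *\<^sub>R (real_of_int i - x, real_of_int j - y)"
    and x: "0 \<le> x" "x \<le> 1" and y: "0 \<le> y" "y \<le> 1" and P: "(i, j) \<in> P_positions m"
    unfolding pattern_def by blast
  obtain I x' where I: "I = 2 * i \<or> I = 2 * i - 1" and x': "0 \<le> x'" "x' \<le> 1"
    "2 * (real_of_int i - x) = real_of_int I - x'"
    by (rule unit_interval_double [OF x])
  obtain J y' where J: "J = 2 * j \<or> J = 2 * j - 1" and y': "0 \<le> y'" "y' \<le> 1"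
    "2 * (real_of_int j - y) = real_of_int J - y'"
    by (rule unit_interval_double [OF y])
  have "z = (real_of_int I - x', real_of_int J - y')"
    by (simp only: z scaleR_Pair real_scaleR_def x' y')
  then show "z \<in> pattern (2 * m)"
    using P x' y' unfolding P_positions_double_iff [OF I J, symmetric] pattern_def by blast
qed

text \<open>A homothety of ratio \<open>r\<close> multiplies every distance by \<open>r\<close> and
  is inverted by the one of ratio \<open>1 / r\<close>.\<close>

lemma similar_figures_scaleR:
  assumes "0 < r"
  shows "similar_figures A ((\<lambda>z. r *\<^sub>R z) ` A)"
proof -
  have "bij (\<lambda>z :: real \<times> real. r *\<^sub>R z)"
    by (rule o_bij [of "\<lambda>z. (1 / r) *\<^sub>R z"]) (use assms in \<open>auto simp: fun_eq_iff\<close>)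
  moreover have "dist (r *\<^sub>R u) (r *\<^sub>R v) = r * dist u v" for u v :: "real \<times> real"
    using assms by (simp add: dist_norm flip: scaleR_diff_right)
  ultimately show ?thesis
    unfolding similar_figures_def using assms by blast
qed

theorem theorem2:
  fixes m :: nat
  assumes "m > 0"
  shows "pattern (2 * m) = (\<lambda>z. (2::real) *\<^sub>R z) ` pattern m
    \<and> similar_figures (pattern m) (pattern (2 * m))"
  unfolding pattern_double by (simp add: similar_figures_scaleR)

end
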